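(* Let $(\bar x,\bar y)\in\mathrm{gph}\,S$, let $f$ be locally Lipschitzian around $(\bar x,\bar y)$ with constant $L$, and assume that $\varPhi$ is Lipschitz-like around $(\bar x,\bar z)$, where $\bar z=f(\bar x,\bar y)$. If the local uniform weak sharp minimum (LUWSM) condition holds at $(\bar x,\bar y)$, then the generalized value function constraint qualification (GVFCQ) is satisfied at $(\bar x,\bar y)$.
   Context: Setting: $f:\mathbb{R}^n\times\mathbb{R}^m\to\mathbb{R}^q$ ($q\ge2$), and $Y:\mathbb{R}^n\rightrightarrows\mathbb{R}^m$ is a set-valued mapping. For a nonempty $\Omega\subset\mathbb{R}^q$, $\mathrm{Eff}(\Omega;\mathbb{R}^q_+)$ is the set of $z\in\Omega$ with $\Omega\subset z+[(\mathbb{R}^q\setminus(-\mathbb{R}^q_+))\cup\{0\}]$, and $\mathrm{WEff}(\Omega;\mathbb{R}^q_+)$ is the set of $z\in\Omega$ with $\Omega\subset z+(\mathbb{R}^q\setminus(-\mathrm{int}\,\mathbb{R}^q_+))$. The frontier map $\varPhi:\mathbb{R}^n\rightrightarrows\mathbb{R}^q$ is either $\varPhi^E(x)=\mathrm{Eff}(f(x,Y(x));\mathbb{R}^q_+)$ or $\varPhi^W(x)=\mathrm{WEff}(f(x,Y(x));\mathbb{R}^q_+)$ (either choice, fixed), where $f(x,Y(x))=\{f(x,y):y\in Y(x)\}$. The solution map is $S(x)=\{y\in Y(x): f(x,y)\in\varPhi(x)\}$. For a set-valued mapping $\Upsilon$, $\mathrm{gph}\,\Upsilon=\{(x,y):y\in\Upsilon(x)\}$;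 $d(\cdot,A)$ is the distance to the set $A$ (with $d(\cdot,\emptyset)=+\infty$). LUWSM at $(\bar x,\bar y)$: there exist $\epsilon>0$ and $\lambda>0$ such that for all $(x,y)$ in the $\epsilon$-neighborhood $V_\epsilon(\bar x,\bar y)$ of $(\bar x,\bar y)$, $y\in Y(x)$ implies $\lambda\,d(y,S(x))\le d(f(x,y),\varPhi(x))$. GVFCQ at $(\bar x,\bar y)$: the set-valued mapping $\Psi:\mathbb{R}^n\times\mathbb{R}^q\rightrightarrows\mathbb{R}^n\times\mathbb{R}^m$, $$\Psi(u,v)=\{(x,y)\in\mathrm{gph}\,Y:\ (x+u,\ f(x,y)+v)\in\mathrm{gph}\,\varPhi\},$$ is calm at $(0,0,\bar x,\bar y)$. A mapping $\Upsilon$ is calm at $(\bar s,\bar t)$ if there are neighborhoods $U$ of $\bar s$, $V$ of $\bar t$ and $l>0$ with $d(t,\Upsilon(\bar s))\le l\|s-\bar s\|$ for all $s\in U$ and $t\in V\cap\Upsilon(s)$. $\Upsilon$ is Lipschitz-like around $(\bar s,\bar t)$ if there are neighborhoods $U$ of $\bar s$, $V$ of $\bar t$ and $l>0$ with $\Upsilon(s)\cap V\subseteq\Upsilon(s')+l\|s-s'\|\mathbb{B}$ for all $s,s'\in U$, $\mathbb{B}$ being the closed unit ball. *)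

theory Defs
  imports "HOL-Analysis.Analysis"
begin

definition nonneg_orthant :: "(real ^ 'q) set" where
  "nonneg_orthant = {v. \<forall>i. 0 \<le> v $ i}"

text \<open>The point-to-set distance is extended-real valued. The library's \<open>infdist\<close> is not
  suitable, because it takes the value 0 on the empty set; here the distance to the empty set
  is \<open>\<infinity>\<close>.\<close>

definition edist_set :: "'a::metric_space \<Rightarrow> 'a set \<Rightarrow> ereal" where
  "edist_set t A = (INF a\<in>A. ereal (dist t a))"

text \<open>A set-valued mapping is a function into sets, possibly with empty values.\<close>

definition gph :: "('a \<Rightarrow> 'b set) \<Rightarrow> ('a \<times> 'b) set" where
  "gph F = {(s, t). t \<in> F s}"

definition calm_at ::
    "('a::real_normed_vector \<Rightarrow> 'b::metric_space set) \<Rightarrow> 'a \<Rightarrow> 'b \<Rightarrow> bool" where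
  "calm_at F sb tb \<longleftrightarrow>
    (\<exists>U V l. open U \<and> sb \<in> U \<and> open V \<and> tb \<in> V \<and> 0 < l \<and>
      (\<forall>s\<in>U. \<forall>t\<in>V \<inter> F s. edist_set t (F sb) \<le> ereal (l * norm (s - sb))))"

definition Lipschitz_like ::
    "('a::real_normed_vector \<Rightarrow> 'b::real_normed_vector set) \<Rightarrow> 'a \<Rightarrow> 'b \<Rightarrow> bool" where
  "Lipschitz_like F sb tb \<longleftrightarrow>
    (\<exists>U V l. open U \<and> sb \<in> U \<and> open V \<and> tb \<in> V \<and> 0 < l \<and>
      (\<forall>s\<in>U. \<forall>s'\<in>U.
        F s \<inter> V \<subseteq> {a + (l * norm (s - s')) *\<^sub>R b | a b. a \<in> F s' \<and> b \<in> cball 0 1}))"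

definition Eff :: "'a::real_normed_vector set \<Rightarrow> 'a set \<Rightarrow> 'a set" where
  "Eff \<Omega> C = {z \<in> \<Omega>. \<Omega> \<subseteq> (\<lambda>w. z + w) ` ((UNIV - uminus ` C) \<union> {0})}"

definition WEff :: "'a::real_normed_vector set \<Rightarrow> 'a set \<Rightarrow> 'a set" where
  "WEff \<Omega> C = {z \<in> \<Omega>. \<Omega> \<subseteq> (\<lambda>w. z + w) ` (UNIV - uminus ` interior C)}"

definition frontier_E ::
    "('x \<times> 'y \<Rightarrow> real ^ 'q) \<Rightarrow> ('x \<Rightarrow> 'y set) \<Rightarrow> 'x \<Rightarrow> (real ^ 'q) set" where
  "frontier_E f Y x = Eff ((\<lambda>y. f (x, y)) ` Y x) nonneg_orthant"

definition frontier_W ::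
    "('x \<times> 'y \<Rightarrow> real ^ 'q) \<Rightarrow> ('x \<Rightarrow> 'y set) \<Rightarrow> 'x \<Rightarrow> (real ^ 'q) set" where
  "frontier_W f Y x = WEff ((\<lambda>y. f (x, y)) ` Y x) nonneg_orthant"

definition solution_map ::
    "('x \<times> 'y \<Rightarrow> 'z) \<Rightarrow> ('x \<Rightarrow> 'y set) \<Rightarrow> ('x \<Rightarrow> 'z set) \<Rightarrow> 'x \<Rightarrow> 'y set" where
  "solution_map f Y \<Phi> x = {y \<in> Y x. f (x, y) \<in> \<Phi> x}"

definition LUWSM ::
    "('x::metric_space \<times> 'y::metric_space \<Rightarrow> 'z::metric_space) \<Rightarrow> ('x \<Rightarrow> 'y set) \<Rightarrow>
      ('x \<Rightarrow> 'z set) \<Rightarrow> 'x \<Rightarrow> 'y \<Rightarrow> bool" where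
  "LUWSM f Y \<Phi> xb yb \<longleftrightarrow>
    (\<exists>\<epsilon> \<mu>. 0 < \<epsilon> \<and> 0 < \<mu> \<and>
      (\<forall>(x, y)\<in>ball (xb, yb) \<epsilon>. y \<in> Y x \<longrightarrow>
        ereal \<mu> * edist_set y (solution_map f Y \<Phi> x) \<le> edist_set (f (x, y)) (\<Phi> x)))"

definition GVFCQ_map ::
    "('x::real_normed_vector \<times> 'y \<Rightarrow> 'z::real_normed_vector) \<Rightarrow> ('x \<Rightarrow> 'y set) \<Rightarrow>
      ('x \<Rightarrow> 'z set) \<Rightarrow> 'x \<times> 'z \<Rightarrow> ('x \<times> 'y) set" where
  "GVFCQ_map f Y \<Phi> = (\<lambda>(u, v). {(x, y) \<in> gph Y. (x + u, f (x, y) + v) \<in> gph \<Phi>})"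

definition GVFCQ ::
    "('x::real_normed_vector \<times> 'y::real_normed_vector \<Rightarrow> 'z::real_normed_vector) \<Rightarrow>
      ('x \<Rightarrow> 'y set) \<Rightarrow> ('x \<Rightarrow> 'z set) \<Rightarrow> 'x \<Rightarrow> 'y \<Rightarrow> bool" where
  "GVFCQ f Y \<Phi> xb yb \<longleftrightarrow> calm_at (GVFCQ_map f Y \<Phi>) (0, 0) (xb, yb)"

end

(* A point (x, y) of Psi(u, v) has f(x, y) + v in Phi(x + u), so the Lipschitz-like property gives
   d(f(x, y), Phi(x)) \<le> |v| + l |u|. LUWSM turns this into a bound on d(y, S(x)), which dominates
   d((x, y), Psi(0, 0)) because {x} \<times> S(x) is contained in Psi(0, 0). *)

theory Submission
  imports Defs
begin

lemma edist_set_le: "a \<in> A \<Longrightarrow> dist t a \<le> r \<Longrightarrow> edist_set t A \<le> ereal r"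
  unfolding edist_set_def by (rule INF_lower2) auto

text \<open>Points sharing the first coordinate \<open>x\<close> are as far apart as their second
  coordinates, so an infimum over fewer competitors stands on the right. If there are none, that
  side is \<open>\<infinity>\<close>, and no separate case arises.\<close>

lemma edist_set_GVFCQ_map_zero_le:
  "edist_set (x, y) (GVFCQ_map f Y \<Phi> (0, 0)) \<le> edist_set y (solution_map f Y \<Phi> x)"
  unfolding edist_set_def
proof (rule INF_mono)
  fix w assume "w \<in> solution_map f Y \<Phi> x"
  then have "(x, w) \<in> GVFCQ_map f Y \<Phi> (0, 0)"
    by (auto simp: GVFCQ_map_def solution_map_def gph_def)
  moreover have "dist (x, y) (x, w) = dist y w"
    by (simp add: dist_Pair_Pair)
  ultimately show "\<exists>p\<in>GVFCQ_map f Y \<Phi> (0, 0). ereal (dist (x, y) p) \<le> ereal (dist y w)"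
    by force
qed

text \<open>The sum with a scaled unit ball is turned into a choice of one close point of
  \<open>F s'\<close>, and both neighborhoods shrink to balls of a common radius. This is the form
  in which the property can be applied to a single perturbed point.\<close>

lemma Lipschitz_like_dist:
  assumes "Lipschitz_like F sb tb"
  shows "\<exists>\<delta> l. 0 < \<delta> \<and> 0 < l \<and>
    (\<forall>s\<in>ball sb \<delta>. \<forall>s'\<in>ball sb \<delta>. \<forall>t\<in>ball tb \<delta> \<inter> F s.
      \<exists>a\<in>F s'. dist t a \<le> l * norm (s - s'))"
proof -
  obtain U V l where UV: "open U" "sb \<in> U" "open V" "tb \<in> V" and l: "0 < l"
    and sub: "\<forall>s\<in>U. \<forall>s'\<in>U.
      F s \<inter> V \<subseteq> {a + (l * norm (s - s')) *\<^sub>R b | a b. a \<in> F s' \<and> b \<in> cball 0 1}"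
    using assms unfolding Lipschitz_like_def by (elim exE conjE) (rule that)
  obtain d1 d2 where d: "0 < d1" "ball sb d1 \<subseteq> U" "0 < d2" "ball tb d2 \<subseteq> V"
    using UV by (meson open_contains_ball)
  show ?thesis
  proof (intro exI conjI ballI)
    show "0 < min d1 d2" "0 < l" using d l by auto
  next
    fix s s' t
    assume *: "s \<in> ball sb (min d1 d2)" "s' \<in> ball sb (min d1 d2)"
      "t \<in> ball tb (min d1 d2) \<inter> F s"
    then have "s \<in> U" "s' \<in> U" "t \<in> F s \<inter> V" using d by auto
    then obtain a b where ab: "t = a + (l * norm (s - s')) *\<^sub>R b" "a \<in> F s'" "norm b \<le> 1"
      using bspec[OF bspec[OF sub \<open>s \<in> U\<close>] \<open>s' \<in> U\<close>] by (auto simp: subset_iff)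
    have "dist t a = l * norm (s - s') * norm b"
      using ab l by (simp add: dist_norm)
    also have "\<dots> \<le> l * norm (s - s')"
      using ab l by (simp add: mult_left_le)
    finally show "\<exists>a\<in>F s'. dist t a \<le> l * norm (s - s')"
      using ab by blast
  qed
qed

text \<open>Continuity of \<open>f\<close> serves to localize: it keeps \<open>f (x, y) + v\<close>
  in the ball around \<open>f (xb, yb)\<close> where the Lipschitz-like estimate is available. The
  estimate itself then combines only \<open>l\<close> and \<open>\<mu>\<close>.\<close>

lemma LUWSM_imp_GVFCQ:
  fixes f :: "'x::real_normed_vector \<times> 'y::real_normed_vector \<Rightarrow> 'z::real_normed_vector"
  assumes cont: "isCont f (xb, yb)"
    and Lip: "Lipschitz_like \<Phi> xb (f (xb, yb))"
    and wsm: "LUWSM f Y \<Phi> xb yb"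
  shows "GVFCQ f Y \<Phi> xb yb"
proof -
  obtain \<delta> l where \<delta>: "0 < \<delta>" and l: "0 < l"
    and near: "\<forall>s\<in>ball xb \<delta>. \<forall>s'\<in>ball xb \<delta>. \<forall>t\<in>ball (f (xb, yb)) \<delta> \<inter> \<Phi> s.
      \<exists>a\<in>\<Phi> s'. dist t a \<le> l * norm (s - s')"
    using Lipschitz_like_dist[OF Lip] by (elim exE conjE) (rule that)
  obtain \<epsilon> \<mu> where \<epsilon>: "0 < \<epsilon>" and \<mu>: "0 < \<mu>"
    and sharp: "\<And>x y. \<lbrakk>(x, y) \<in> ball (xb, yb) \<epsilon>; y \<in> Y x\<rbrakk> \<Longrightarrow>
      ereal \<mu> * edist_set y (solution_map f Y \<Phi> x) \<le> edist_set (f (x, y)) (\<Phi> x)"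
    using wsm unfolding LUWSM_def by fast
  obtain \<eta> where \<eta>: "0 < \<eta>" "\<And>p. dist p (xb, yb) < \<eta> \<Longrightarrow> dist (f p) (f (xb, yb)) < \<delta> / 2"
    using cont \<delta> unfolding continuous_at_eps_delta by (metis half_gt_zero)
  \<comment> \<open>\<open>\<epsilon>\<close> is the range of LUWSM and \<open>\<eta>\<close> that
    of continuity. The bound \<open>\<delta> / 2\<close> on \<open>x\<close> leaves the other half
    of \<open>\<delta>\<close> for the shift by \<open>u\<close>; likewise \<open>\<eta>\<close>
    leaves half of it for \<open>v\<close>.\<close>
  define \<rho> where "\<rho> = min \<epsilon> (min \<eta> (\<delta> / 2))"
  show ?thesis
    unfolding GVFCQ_def calm_at_def
  proof (intro exI conjI ballI)
    \<comment> \<open>In the modulus \<open>(1 + l) / \<mu>\<close>, the 1 pays for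
      \<open>v\<close>, the \<open>l\<close> for \<open>u\<close>, and the division by
      \<open>\<mu>\<close> comes from LUWSM.\<close>
    show "open (ball (0 :: 'x \<times> 'z) (\<delta> / 2))" "(0, 0) \<in> ball (0 :: 'x \<times> 'z) (\<delta> / 2)"
      "open (ball (xb, yb) \<rho>)" "(xb, yb) \<in> ball (xb, yb) \<rho>" "0 < (1 + l) / \<mu>"
      using \<delta> \<epsilon> \<eta> l \<mu> by (auto simp: \<rho>_def zero_prod_def)
  next
    fix s t
    assume s: "s \<in> ball (0 :: 'x \<times> 'z) (\<delta> / 2)" and t: "t \<in> ball (xb, yb) \<rho> \<inter> GVFCQ_map f Y \<Phi> s"
    obtain u v where suv: "s = (u, v)" by (cases s)
    obtain x y where txy: "t = (x, y)" by (cases t)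
    have u_le: "norm u \<le> norm s" and v_le: "norm v \<le> norm s"
      using norm_fst_le[of u v] norm_snd_le[of v u] by (auto simp: suv)
    have dxy: "dist (x, y) (xb, yb) < \<rho>"
      using t by (simp add: txy dist_commute)
    have y: "y \<in> Y x" and \<Phi>: "f (x, y) + v \<in> \<Phi> (x + u)"
      using t by (auto simp: txy suv GVFCQ_map_def gph_def)
    have x: "dist x xb < \<delta> / 2"
      using dxy dist_fst_le[of "(x, y)" "(xb, yb)"] by (simp add: \<rho>_def)
    have "dist (x + u) xb \<le> dist x xb + norm u"
      using norm_triangle_ineq[of "x - xb" u] by (simp add: dist_norm algebra_simps)
    then have xu: "dist (x + u) xb < \<delta>"
      using x u_le s by simp
    have "dist (f (x, y)) (f (xb, yb)) < \<delta> / 2"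
      using \<eta>(2)[of "(x, y)"] dxy by (simp add: \<rho>_def)
    moreover have "dist (f (x, y) + v) (f (xb, yb)) \<le> dist (f (x, y)) (f (xb, yb)) + norm v"
      using norm_triangle_ineq[of "f (x, y) - f (xb, yb)" v] by (simp add: dist_norm algebra_simps)
    ultimately have "dist (f (x, y) + v) (f (xb, yb)) < \<delta>"
      using v_le s by simp
    \<comment> \<open>The Lipschitz-like estimate goes from \<open>x + u\<close> back to
      \<open>x\<close>, two base points that differ by exactly \<open>u\<close>.\<close>
    then obtain a where a: "a \<in> \<Phi> x" "dist (f (x, y) + v) a \<le> l * norm u"
      using bspec[OF bspec[OF bspec[OF near, of "x + u"], of x], of "f (x, y) + v"] x xu \<Phi> \<delta>
      by (auto simp: dist_commute)
    have "dist (f (x, y)) a \<le> norm v + dist (f (x, y) + v) a"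
      using dist_triangle[of "f (x, y)" a "f (x, y) + v"] by (simp add: dist_norm)
    also have "\<dots> \<le> norm s + l * norm s"
      using a v_le u_le l by (meson add_mono mult_left_mono less_imp_le order_trans)
    finally have "edist_set (f (x, y)) (\<Phi> x) \<le> ereal ((1 + l) * norm s)"
      using a by (intro edist_set_le) (auto simp: algebra_simps)
    then have "ereal \<mu> * edist_set y (solution_map f Y \<Phi> x) \<le> ereal ((1 + l) * norm s)"
      using sharp[of x y] dxy y by (auto simp: \<rho>_def dist_commute intro: order_trans)
    \<comment> \<open>The case split rules out the value \<open>\<infinity>\<close>: multiplied by
      \<open>\<mu> > 0\<close> it would stay infinite, against the finite bound. In particular the
      solution set at \<open>x\<close> is nonempty.\<close>
    then have "edist_set y (solution_map f Y \<Phi> x) \<le> ereal ((1 + l) / \<mu> * norm s)"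
      using \<mu> by (cases "edist_set y (solution_map f Y \<Phi> x)") (auto simp: field_simps)
    then show "edist_set t (GVFCQ_map f Y \<Phi> (0, 0)) \<le> ereal ((1 + l) / \<mu> * norm (s - (0, 0)))"
      using edist_set_GVFCQ_map_zero_le[of x y f Y \<Phi>]
      by (simp add: txy suv)
  qed
qed

theorem theorem3p3:
  fixes f :: "(real ^ 'n) \<times> (real ^ 'm) \<Rightarrow> real ^ 'q"
    and Y :: "real ^ 'n \<Rightarrow> (real ^ 'm) set"
    and \<Phi> :: "real ^ 'n \<Rightarrow> (real ^ 'q) set"
    and xb :: "real ^ 'n" and yb :: "real ^ 'm" and L :: real
  assumes "2 \<le> CARD('q)"
    and "\<Phi> = frontier_E f Y \<or> \<Phi> = frontier_W f Y"
    and "(xb, yb) \<in> gph (solution_map f Y \<Phi>)"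
    and "\<exists>U. open U \<and> (xb, yb) \<in> U \<and> L-lipschitz_on U f"
    and "Lipschitz_like \<Phi> xb (f (xb, yb))"
    and "LUWSM f Y \<Phi> xb yb"
  shows "GVFCQ f Y \<Phi> xb yb"
proof -
  obtain U where "open U" "(xb, yb) \<in> U" "L-lipschitz_on U f"
    using assms(4) by blast
  then have "isCont f (xb, yb)"
    using lipschitz_on_continuous_on continuous_on_eq_continuous_at by blast
  then show ?thesis
    using assms(5,6) by (rule LUWSM_imp_GVFCQ)
qed

end
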